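(* Let $(S,\sim,\cdot)$ satisfy axioms A1–A7 (listed in the context), and let $\overrightarrow{S}$ be the set of vectors. Addition of vectors makes $\overrightarrow{S}$ into a commutative group; that is, for all $\overrightarrow{a},\overrightarrow{b},\overrightarrow{c}\in\overrightarrow{S}$: 1. $(\overrightarrow{a}+\overrightarrow{b})+\overrightarrow{c}=\overrightarrow{a}+(\overrightarrow{b}+\overrightarrow{c})$; 2. $\overrightarrow{a}+\overrightarrow{0}=\overrightarrow{a}$; 3. $\overrightarrow{a}+(-\overrightarrow{a})=\overrightarrow{0}$; 4. $\overrightarrow{a}+\overrightarrow{b}=\overrightarrow{b}+\overrightarrow{a}$.
   Context: $S$ is a non-empty set whose elements are called points. An ordered pair $(A,B)\in S^2$ is written $AB$ and called an arrow. The primitive notions are a binary relation $\sim$ on $S^2$ and a multiplication $\cdot:\mathbb{R}\times S^2\to S^2$, $(\lambda,AB)\mapsto\lambda\cdot AB$ (also written $\lambda AB$). Addition of arrows: $AB+BC=AC$; more generally $AB+CD=AB+BX=AX$, where $X$ is a point with $BX\sim CD$, provided such a point exists (it is then unique by A2). Axioms (for all points and all real $\lambda,\mu$): A1: $\sim$ is an equivalence relation on $S^2$. A2: $AB\sim AC\Rightarrow B=C$. A3.1: $AB\sim A'B'\Rightarrow BA\sim B'A'$. A3.2: $AB\sim A'B'$ and $BC\sim B'C'$ imply $AC\sim A'C'$. A4: for all $\lambda,A,B$ there is $C$ with $\lambda\cdot AB=AC$. A5: $AB\sim CD\Rightarrow\lambda AB\sim\lambda CD$. A6.1: $1\cdot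 AB=AB$. A6.2: $\lambda\cdot AB+\mu\cdot AB=(\lambda+\mu)\cdot AB$ (in particular the left side is defined). A6.3: $\lambda\cdot(\mu\cdot AB)=(\lambda\mu)\cdot AB$. A7: if $AC=\lambda\cdot AB$ and $AC'=\lambda\cdot AB'$, then $CC'\sim\lambda\cdot BB'$. Vectors: $\overrightarrow{AB}=\{CD : CD\sim AB\}$ is the $\sim$-class of $AB$, and $\overrightarrow{S}$ is the set of all these classes. Null vector: $\overrightarrow{0}=\overrightarrow{AA}$ (for any point $A$). Inverse vector: $-\overrightarrow{AB}=\overrightarrow{BA}$. Addition of vectors: $\overrightarrow{AB}+\overrightarrow{BC}=\overrightarrow{AC}$ (any two vectors can be represented by arrows of the form $AB$, $BC$). These definitions do not depend on the choice of representing arrows. *)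

theory Defs
  imports Complex_Main "HOL-Algebra.Group"
begin

text \<open>
  An arrow \<open>AB\<close> is the pair \<open>(A, B)\<close> of points of a carrier \<open>S\<close>; the relation \<open>\<sim>\<close> on arrows is
  a set \<open>R\<close> of pairs of arrows.
\<close>

text \<open>
  Addition of arrows is partial, so it is rendered by its graph: \<open>AB + CD\<close> is defined and equal to
  \<open>AX\<close> iff \<open>BX \<sim> CD\<close>. (Axiom \<open>A2\<close> below makes \<open>X\<close> unique.)
\<close>

definition arrow_sum :: "('a \<times> 'a) rel \<Rightarrow> 'a \<times> 'a \<Rightarrow> 'a \<times> 'a \<Rightarrow> 'a \<times> 'a \<Rightarrow> bool" where
  "arrow_sum R p q r \<longleftrightarrow> fst r = fst p \<and> ((snd p, snd r), q) \<in> R"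

text \<open>
  By \<open>A1\<close>, \<open>R\<close> relates only arrows of \<open>S\<close>, so hypotheses stated through \<open>R\<close> already
  place their points in \<open>S\<close>.
\<close>

locale arrow_space =
  fixes S :: "'a set"
    and R :: "('a \<times> 'a) rel"
    and smult :: "real \<Rightarrow> 'a \<times> 'a \<Rightarrow> 'a \<times> 'a"
  assumes nonempty: "S \<noteq> {}"
    and smult_closed: "p \<in> S \<times> S \<Longrightarrow> smult l p \<in> S \<times> S"
    and A1: "equiv (S \<times> S) R"
    and A2: "((A, B), (A, C)) \<in> R \<Longrightarrow> B = C"
    and A3_1: "((A, B), (A', B')) \<in> R \<Longrightarrow> ((B, A), (B', A')) \<in> R"
    and A3_2: "\<lbrakk>((A, B), (A', B')) \<in> R; ((B, C), (B', C')) \<in> R\<rbrakk> \<Longrightarrow> ((A, C), (A', C')) \<in> R"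
    and A4: "\<lbrakk>A \<in> S; B \<in> S\<rbrakk> \<Longrightarrow> \<exists>C\<in>S. smult l (A, B) = (A, C)"
    and A5: "((A, B), (C, D)) \<in> R \<Longrightarrow> (smult l (A, B), smult l (C, D)) \<in> R"
    and A6_1: "\<lbrakk>A \<in> S; B \<in> S\<rbrakk> \<Longrightarrow> smult 1 (A, B) = (A, B)"
    and A6_2: "\<lbrakk>A \<in> S; B \<in> S\<rbrakk> \<Longrightarrow>
      arrow_sum R (smult l (A, B)) (smult m (A, B)) (smult (l + m) (A, B))"
    and A6_3: "\<lbrakk>A \<in> S; B \<in> S\<rbrakk> \<Longrightarrow> smult l (smult m (A, B)) = smult (l * m) (A, B)"
    and A7: "\<lbrakk>A \<in> S; B \<in> S; B' \<in> S; C \<in> S; C' \<in> S;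
        smult l (A, B) = (A, C); smult l (A, B') = (A, C')\<rbrakk> \<Longrightarrow>
      ((C, C'), smult l (B, B')) \<in> R"

definition vec :: "('a \<times> 'a) rel \<Rightarrow> 'a \<Rightarrow> 'a \<Rightarrow> ('a \<times> 'a) set" where
  "vec R A B = R `` {(A, B)}"

definition vectors :: "'a set \<Rightarrow> ('a \<times> 'a) rel \<Rightarrow> ('a \<times> 'a) set set" where
  "vectors S R = (S \<times> S) // R"

text \<open>
  The operations on vectors are given by representing arrows. The lemmas \<open>vec_zero_eq\<close>,
  \<open>vec_neg_eq\<close>, \<open>vec_add_eq\<close> and \<open>vectors_representable\<close> below show that each description has
  a unique solution.
\<close>

definition vec_zero :: "'a set \<Rightarrow> ('a \<times> 'a) rel \<Rightarrow> ('a \<times> 'a) set" where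
  "vec_zero S R = (THE v. \<exists>A\<in>S. v = vec R A A)"

definition vec_neg :: "'a set \<Rightarrow> ('a \<times> 'a) rel \<Rightarrow> ('a \<times> 'a) set \<Rightarrow> ('a \<times> 'a) set" where
  "vec_neg S R a = (THE v. \<exists>A\<in>S. \<exists>B\<in>S. a = vec R A B \<and> v = vec R B A)"

definition vec_add ::
  "'a set \<Rightarrow> ('a \<times> 'a) rel \<Rightarrow> ('a \<times> 'a) set \<Rightarrow> ('a \<times> 'a) set \<Rightarrow> ('a \<times> 'a) set" where
  "vec_add S R a b =
    (THE c. \<exists>A\<in>S. \<exists>B\<in>S. \<exists>C\<in>S. a = vec R A B \<and> b = vec R B C \<and> c = vec R A C)"

definition vector_group :: "'a set \<Rightarrow> ('a \<times> 'a) rel \<Rightarrow> ('a \<times> 'a) set monoid" where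
  "vector_group S R = \<lparr>carrier = vectors S R, mult = vec_add S R, one = vec_zero S R\<rparr>"

context arrow_space
begin

lemma R_refl: "A \<in> S \<Longrightarrow> B \<in> S \<Longrightarrow> ((A, B), (A, B)) \<in> R"
  using A1 by (auto simp: equiv_def refl_on_def)

lemma R_sym: "(p, q) \<in> R \<Longrightarrow> (q, p) \<in> R"
  using A1 by (auto simp: equiv_def dest: symD)

lemma R_trans: "(p, q) \<in> R \<Longrightarrow> (q, r) \<in> R \<Longrightarrow> (p, r) \<in> R"
  using A1 by (auto simp: equiv_def dest: transD)

lemma vec_eq_iff:
  assumes "A \<in> S" "B \<in> S" "C \<in> S" "D \<in> S"
  shows "vec R A B = vec R C D \<longleftrightarrow> ((A, B), (C, D)) \<in> R"
  unfolding vec_def using eq_equiv_class_iff[OF A1] assms by auto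

lemma null_arrows:
  assumes "A \<in> S" "B \<in> S"
  shows "((A, A), (B, B)) \<in> R"
proof -
  obtain X where X: "X \<in> S" "smult 0 (A, B) = (A, X)"
    using A4 assms by blast
  have "((B, B), (A, X)) \<in> R"
    using A6_2[OF assms, of 1 0] X A6_1[OF assms] by (simp add: arrow_sum_def)
  then have "((A, X), (B, B)) \<in> R" by (rule R_sym)
  then show ?thesis using A3_2[OF _ A3_1] by blast
qed

lemma neg_arrow:
  assumes "A \<in> S" "B \<in> S"
  shows "(smult (- 1) (A, B), (B, A)) \<in> R"
proof -
  obtain X where X: "X \<in> S" "smult 0 (A, B) = (A, X)"
    using A4 assms by blast
  have "((B, B), (A, X)) \<in> R"
    using A6_2[OF assms, of 1 0] X A6_1[OF assms] by (simp add: arrow_sum_def)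
  then have "((A, A), (A, X)) \<in> R" by (rule R_trans[OF null_arrows[OF assms]])
  then have "X = A" by (blast dest: A2)
  then have "((B, A), smult (- 1) (A, B)) \<in> R"
    using A6_2[OF assms, of 1 "- 1"] X A6_1[OF assms] by (simp add: arrow_sum_def)
  then show ?thesis by (rule R_sym)
qed

lemma arrow_transport:
  assumes "B \<in> S" "C \<in> S" "D \<in> S"
  shows "\<exists>X\<in>S. ((B, X), (D, C)) \<in> R"
proof -
  obtain M where M: "M \<in> S" "smult (1/2) (B, C) = (B, M)"
    using A4 assms by blast
  have "((M, C), (B, M)) \<in> R"
    using A6_2[of B C "1/2" "1/2"] M A6_1[of B C] assms by (simp add: arrow_sum_def)
  then have MC: "((C, M), (M, B)) \<in> R" by (rule A3_1)
  obtain C' where C': "C' \<in> S" "smult (- 1) (M, C) = (M, C')"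
    using A4 assms M by blast
  have "((M, C'), (C, M)) \<in> R"
    using neg_arrow[of M C] M assms C' by simp
  then have "((M, C'), (M, B)) \<in> R" by (rule R_trans[OF _ MC])
  then have CB: "C' = B" by (rule A2)
  obtain X where X: "X \<in> S" "smult (- 1) (M, D) = (M, X)"
    using A4 assms M by blast
  have "((X, B), smult (- 1) (D, C)) \<in> R"
    by (rule A7[where A = M]) (use M X C' CB assms in auto)
  then have "((X, B), (C, D)) \<in> R" by (rule R_trans) (use neg_arrow assms in simp)
  then have "((B, X), (D, C)) \<in> R" by (rule A3_1)
  then show ?thesis using X by blast
qed

lemma vectors_representable:
  assumes "a \<in> vectors S R" "b \<in> vectors S R"
  shows "\<exists>A\<in>S. \<exists>B\<in>S. \<exists>C\<in>S. a = vec R A B \<and> b = vec R B C"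
proof -
  obtain A B where a: "A \<in> S" "B \<in> S" "a = vec R A B"
    using assms(1) by (auto simp: vectors_def vec_def quotient_def)
  obtain C D where b: "C \<in> S" "D \<in> S" "b = vec R C D"
    using assms(2) by (auto simp: vectors_def vec_def quotient_def)
  obtain X where "X \<in> S" "((B, X), (C, D)) \<in> R"
    using arrow_transport[of B D C] a b by blast
  then have "b = vec R B X" using vec_eq_iff[of B X C D] a b by simp
  then show ?thesis using a \<open>X \<in> S\<close> by blast
qed

lemma vec_zero_eq:
  assumes "A \<in> S"
  shows "vec_zero S R = vec R A A"
  unfolding vec_zero_def
proof (rule the_equality)
  show "\<exists>B\<in>S. vec R A A = vec R B B" using assms by blast
next
  fix v assume "\<exists>B\<in>S. v = vec R B B"
  then obtain B where "B \<in> S" "v = vec R B B" by blast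
  then show "v = vec R A A"
    using vec_eq_iff[of B B A A] null_arrows[of B A] assms by simp
qed

lemma vec_neg_eq:
  assumes "A \<in> S" "B \<in> S"
  shows "vec_neg S R (vec R A B) = vec R B A"
  unfolding vec_neg_def
proof (rule the_equality)
  show "\<exists>C\<in>S. \<exists>D\<in>S. vec R A B = vec R C D \<and> vec R B A = vec R D C"
    using assms by blast
next
  fix v assume "\<exists>C\<in>S. \<exists>D\<in>S. vec R A B = vec R C D \<and> v = vec R D C"
  then obtain C D where *: "C \<in> S" "D \<in> S" "vec R A B = vec R C D" "v = vec R D C"
    by blast
  then have "((A, B), (C, D)) \<in> R" using vec_eq_iff[of A B C D] assms by simp
  then have "((B, A), (D, C)) \<in> R" by (rule A3_1)
  then show "v = vec R B A" using * vec_eq_iff[of B A D C] assms by simp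
qed

lemma vec_add_eq:
  assumes "A \<in> S" "B \<in> S" "C \<in> S"
  shows "vec_add S R (vec R A B) (vec R B C) = vec R A C"
  unfolding vec_add_def
proof (rule the_equality)
  show "\<exists>D\<in>S. \<exists>E\<in>S. \<exists>F\<in>S. vec R A B = vec R D E \<and> vec R B C = vec R E F \<and>
      vec R A C = vec R D F"
    using assms by blast
next
  fix v assume "\<exists>D\<in>S. \<exists>E\<in>S. \<exists>F\<in>S. vec R A B = vec R D E \<and> vec R B C = vec R E F \<and>
      v = vec R D F"
  then obtain D E F where *: "D \<in> S" "E \<in> S" "F \<in> S"
      "vec R A B = vec R D E" "vec R B C = vec R E F" "v = vec R D F"
    by blast
  then have "((A, B), (D, E)) \<in> R" "((B, C), (E, F)) \<in> R"
    using vec_eq_iff[of A B D E] vec_eq_iff[of B C E F] assms by simp_all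
  then have "((A, C), (D, F)) \<in> R" by (rule A3_2)
  then show "v = vec R A C" using * vec_eq_iff[of A C D F] assms by simp
qed

end

end

theory Submission
  imports Defs
begin

text \<open>
  Every vector has a representing arrow that starts at any prescribed point. So vectors can be laid
  end to end, and then Chasles' rule \<open>AB + BC = AC\<close> makes associativity, the neutral element and
  inverses immediate.

  Commutativity is the existence of parallelograms: if \<open>A\<close>, \<open>B\<close>, \<open>C\<close> are points, there is a point
  \<open>D\<close> with \<open>AD \<sim> BC\<close> and \<open>DC \<sim> AB\<close>, and then \<open>AB + BC = AC = AD + DC\<close>. The point \<open>D\<close> is the image
  of \<open>B\<close> under the point reflection in the midpoint of \<open>AC\<close>. This reflection swaps \<open>A\<close> and \<open>C\<close>
  and, by axiom \<open>A7\<close> with factor \<open>-1\<close>, it reverses all arrows (\<open>parallelogram_completion\<close>).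
\<close>

context arrow_space
begin

lemma vec_in_vectors: "A \<in> S \<Longrightarrow> B \<in> S \<Longrightarrow> vec R A B \<in> vectors S R"
  by (auto simp: vectors_def vec_def intro: quotientI)

lemma vector_from_point:
  assumes "a \<in> vectors S R" "A \<in> S"
  obtains B where "B \<in> S" "a = vec R A B"
proof -
  obtain C D where CD: "C \<in> S" "D \<in> S" "a = vec R C D"
    using vectors_representable[OF assms(1) assms(1)] by blast
  obtain X where "X \<in> S" "((A, X), (C, D)) \<in> R"
    using arrow_transport[OF assms(2) CD(2,1)] by blast
  then show thesis
    using that[of X] vec_eq_iff[of A X C D] assms(2) CD by simp
qed

text \<open>
  The midpoint is \<open>M = A + 1/2 AC\<close>: the two halves \<open>AM\<close> and \<open>MC\<close> are equivalent by \<open>A6_2\<close>, and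
  multiplication by \<open>-1\<close> amounts to reversing an arrow.
\<close>
lemma midpoint_exists:
  assumes "A \<in> S" "C \<in> S"
  obtains M where "M \<in> S" "smult (- 1) (M, A) = (M, C)" "smult (- 1) (M, C) = (M, A)"
proof -
  obtain M where M: "M \<in> S" "smult (1/2) (A, C) = (A, M)"
    using A4 assms by blast
  have half: "((M, C), (A, M)) \<in> R"
    using A6_2[of A C "1/2" "1/2"] M A6_1[of A C] assms by (simp add: arrow_sum_def)
  have reflect: "smult (- 1) (M, P) = (M, Q)"
    if "P \<in> S" and PQ: "((P, M), (M, Q)) \<in> R" for P Q
  proof -
    obtain X where X: "smult (- 1) (M, P) = (M, X)"
      using A4 M(1) \<open>P \<in> S\<close> by blast
    have "((M, X), (M, Q)) \<in> R"
      using R_trans[OF neg_arrow[OF M(1) \<open>P \<in> S\<close>] PQ] X by simp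
    with X show ?thesis by (blast dest: A2)
  qed
  show thesis
    by (rule that[OF M(1) reflect[OF assms(1) R_sym[OF half]] reflect[OF assms(2) A3_1[OF half]]])
qed

lemma parallelogram_completion:
  assumes "A \<in> S" "B \<in> S" "C \<in> S"
  obtains D where "D \<in> S" "((A, D), (B, C)) \<in> R" "((D, C), (A, B)) \<in> R"
proof -
  obtain M where M: "M \<in> S" "smult (- 1) (M, A) = (M, C)" "smult (- 1) (M, C) = (M, A)"
    using midpoint_exists assms by blast
  obtain D where D: "D \<in> S" "smult (- 1) (M, B) = (M, D)"
    using A4 M(1) assms by blast
  have reverse: "((Q', P'), (P, Q)) \<in> R"
    if "P \<in> S" "Q \<in> S" "P' \<in> S" "Q' \<in> S"
      "smult (- 1) (M, P) = (M, P')" "smult (- 1) (M, Q) = (M, Q')" for P Q P' Q'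
    by (rule A3_1, rule R_trans[OF A7[OF M(1) that]], rule neg_arrow) (fact that)+
  show thesis
    by (rule that[OF D(1)])
      (rule reverse; fact assms D(1) D(2) M)+
qed

lemma vec_add_closed:
  assumes "a \<in> vectors S R" "b \<in> vectors S R"
  shows "vec_add S R a b \<in> vectors S R"
  using vectors_representable[OF assms] by (auto simp: vec_add_eq vec_in_vectors)

lemma vec_zero_closed: "vec_zero S R \<in> vectors S R"
  using nonempty by (auto simp: vec_zero_eq vec_in_vectors)

lemma vec_neg_closed:
  assumes "a \<in> vectors S R"
  shows "vec_neg S R a \<in> vectors S R"
  using vectors_representable[OF assms assms] by (auto simp: vec_neg_eq vec_in_vectors)

lemma vec_add_assoc:
  assumes "a \<in> vectors S R" "b \<in> vectors S R" "c \<in> vectors S R"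
  shows "vec_add S R (vec_add S R a b) c = vec_add S R a (vec_add S R b c)"
proof -
  obtain A B C where ABC: "A \<in> S" "B \<in> S" "C \<in> S" "a = vec R A B" "b = vec R B C"
    using vectors_representable[OF assms(1,2)] by blast
  obtain D where "D \<in> S" "c = vec R C D"
    using vector_from_point[OF assms(3) ABC(3)] .
  with ABC show ?thesis by (simp add: vec_add_eq)
qed

lemma vec_add_zero:
  assumes "a \<in> vectors S R"
  shows "vec_add S R a (vec_zero S R) = a"
proof -
  obtain A B where "A \<in> S" "B \<in> S" "a = vec R A B"
    using vectors_representable[OF assms assms] by blast
  then show ?thesis by (simp add: vec_zero_eq[of B] vec_add_eq)
qed

lemma vec_add_neg:
  assumes "a \<in> vectors S R"
  shows "vec_add S R a (vec_neg S R a) = vec_zero S R"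
proof -
  obtain A B where "A \<in> S" "B \<in> S" "a = vec R A B"
    using vectors_representable[OF assms assms] by blast
  then show ?thesis by (simp add: vec_zero_eq[of A] vec_neg_eq vec_add_eq)
qed

lemma vec_add_commute:
  assumes "a \<in> vectors S R" "b \<in> vectors S R"
  shows "vec_add S R a b = vec_add S R b a"
proof -
  obtain A B C where ABC: "A \<in> S" "B \<in> S" "C \<in> S" "a = vec R A B" "b = vec R B C"
    using vectors_representable[OF assms] by blast
  obtain D where D: "D \<in> S" "((A, D), (B, C)) \<in> R" "((D, C), (A, B)) \<in> R"
    using parallelogram_completion[OF ABC(1-3)] .
  have "b = vec R A D" "a = vec R D C"
    using vec_eq_iff[of A D B C] vec_eq_iff[of D C A B] ABC D by simp_all
  then have "vec_add S R b a = vec R A C"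
    using vec_add_eq[of A D C] ABC D by simp
  then show ?thesis
    using vec_add_eq[of A B C] ABC by simp
qed

lemma comm_group_vectors: "comm_group (vector_group S R)"
proof (rule comm_groupI)
  fix a assume "a \<in> carrier (vector_group S R)"
  then have a: "a \<in> vectors S R" by (simp add: vector_group_def)
  show "\<one>\<^bsub>vector_group S R\<^esub> \<otimes>\<^bsub>vector_group S R\<^esub> a = a"
    using a vec_add_zero vec_add_commute[OF vec_zero_closed]
    by (simp add: vector_group_def)
  show "\<exists>b\<in>carrier (vector_group S R). b \<otimes>\<^bsub>vector_group S R\<^esub> a = \<one>\<^bsub>vector_group S R\<^esub>"
    by (rule bexI[of _ "vec_neg S R a"])
      (use a vec_add_neg vec_neg_closed vec_add_commute[OF vec_neg_closed] in
        \<open>simp_all add: vector_group_def\<close>)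
qed (simp_all add: vector_group_def vec_add_closed vec_zero_closed vec_add_assoc,
    rule vec_add_commute)

end

theorem theoremW3:
  fixes S :: "'a set"
    and R :: "('a \<times> 'a) rel"
    and smult :: "real \<Rightarrow> 'a \<times> 'a \<Rightarrow> 'a \<times> 'a"
  assumes "arrow_space S R smult"
  shows "comm_group (vector_group S R) \<and>
    (\<forall>a\<in>vectors S R. vec_neg S R a \<in> vectors S R) \<and>
    (\<forall>a\<in>vectors S R. \<forall>b\<in>vectors S R. \<forall>c\<in>vectors S R.
      vec_add S R (vec_add S R a b) c = vec_add S R a (vec_add S R b c) \<and>
      vec_add S R a (vec_zero S R) = a \<and>
      vec_add S R a (vec_neg S R a) = vec_zero S R \<and>
      vec_add S R a b = vec_add S R b a)"
proof -
  interpret arrow_space S R smult by (fact assms)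
  show ?thesis
    using comm_group_vectors vec_neg_closed vec_add_assoc vec_add_zero vec_add_neg vec_add_commute
    by simp
qed

end
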